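(* Let $q$ be a complex number with $|q|<1$. Then \[ \sum_{j,\,k\geq0}\frac{q^{4j^2+4jk+2k^2-j}}{(q;q)_{2j}(q^2;q^2)_k} =\frac{(q^8,-q^3,-q^5;q^8)_{\infty}}{(q^2;q^2)_{\infty}}, \qquad \sum_{j,\,k\geq0}\frac{q^{4j^2+4jk+2k^2+3j+2k}}{(q;q)_{1+2j}(q^2;q^2)_k} =\frac{(q^8,-q,-q^7;q^8)_{\infty}}{(q^2;q^2)_{\infty}}. \]
   Context: For complex $a$ and $|q|<1$, $(a;q)_\infty=\prod_{i=0}^{\infty}(1-aq^i)$, $(a;q)_n=(a;q)_\infty/(aq^n;q)_\infty$ for nonnegative integers $n$, and $(a_1,\dots,a_r;q)_\infty=(a_1;q)_\infty\cdots(a_r;q)_\infty$. *)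

theory Defs
  imports "HOL-Analysis.Analysis"
begin

definition qpoch_inf :: "complex \<Rightarrow> complex \<Rightarrow> complex" where
  "qpoch_inf a q = (\<Prod>i. 1 - a * q ^ i)"

(* As a quotient of infinite products, this is the usual finite product only when
   the denominator does not vanish. That holds whenever norm q < 1 and a = q. *)
definition qpoch :: "complex \<Rightarrow> complex \<Rightarrow> nat \<Rightarrow> complex" where
  "qpoch a q n = qpoch_inf a q / qpoch_inf (a * q ^ n) q"

definition qpoch_inf_list :: "complex list \<Rightarrow> complex \<Rightarrow> complex" where
  "qpoch_inf_list as q = (\<Prod>a\<leftarrow>as. qpoch_inf a q)"

end

theory Submission
  imports Defs
begin

text \<open>
  With \<open>n = j + k\<close> the exponents become \<open>2n\<^sup>2 + 2j\<^sup>2 - j\<close> and \<open>2n\<^sup>2 + 2n + 2j\<^sup>2 + j\<close>, and the sum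
  over \<open>j\<close> is a limiting case of the \<open>q\<close>-Chu--Vandermonde formula in base \<open>q\<^sup>2\<close>. What remains are
  Slater's identities (39) and (38), with summands \<open>q ^ (2n\<^sup>2) / (q;q)_(2n)\<close> and
  \<open>q ^ (2n\<^sup>2 + 2n) / (q;q)_(2n+1)\<close>. For \<open>s\<^sup>2 = q\<close>, these are the even and odd parts in \<open>s\<close> of
  Euler's series for \<open>(-s;q)_\<infinity>\<close>. On the other hand \<open>(q\<^sup>2;q\<^sup>2)_\<infinity> (-s;q)_\<infinity>\<close> is the theta series
  of \<open>s ^ (2n\<^sup>2 + n)\<close>, whose even and odd parts are again products by the Jacobi triple product.
  Comparing \<open>s\<close> with \<open>-s\<close> separates the parts. Euler's series and the triple product are limits,
  by Tannery's theorem, of their finite versions.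
\<close>

section \<open>Finite q-Pochhammer symbols and Gaussian binomials\<close>

definition fpoch :: "complex \<Rightarrow> complex \<Rightarrow> nat \<Rightarrow> complex" where
  "fpoch a q n = (\<Prod>i<n. 1 - a * q ^ i)"

text \<open>Gaussian binomial coefficient. The explicit zero for \<open>k > n\<close> is needed
  because \<open>n - k\<close> truncates at 0; it also lets sums over \<open>k\<close> run past
  \<open>n\<close>.\<close>

definition qbinom :: "complex \<Rightarrow> nat \<Rightarrow> nat \<Rightarrow> complex" where
  "qbinom q n k = (if k \<le> n then fpoch q q n / (fpoch q q k * fpoch q q (n - k)) else 0)"

text \<open>Summand of Ramanujan's general theta function. Both exponents are triangular numbers,
  hence nonnegative for every integer \<open>n\<close>, so \<open>nat\<close> loses nothing and
  \<open>a\<close> or \<open>b\<close> may be 0.\<close>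

definition theta_term :: "complex \<Rightarrow> complex \<Rightarrow> int \<Rightarrow> complex" where
  "theta_term a b n = a ^ nat (n * (n - 1) div 2) * b ^ nat (n * (n + 1) div 2)"

lemma fpoch_0 [simp]: "fpoch a q 0 = 1"
  by (simp add: fpoch_def)

lemma fpoch_Suc: "fpoch a q (Suc n) = fpoch a q n * (1 - a * q ^ n)"
  by (simp add: fpoch_def)

lemma fpoch_Suc_shift: "fpoch a q (Suc n) = (1 - a) * fpoch (a * q) q n"
  unfolding fpoch_def by (subst prod.lessThan_Suc_shift) (simp add: mult.assoc)

lemma fpoch_even: "fpoch a q (2 * n) = fpoch a (q\<^sup>2) n * fpoch (a * q) (q\<^sup>2) n"
  by (induction n) (simp_all add: fpoch_Suc power_mult[symmetric] mult_ac)

lemma norm_mult_power_less_1: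
  fixes a q :: complex
  assumes "norm a < 1" "norm q < 1"
  shows "norm (a * q ^ i) < 1"
proof -
  have "norm a * norm q ^ i \<le> norm a * 1"
    using assms by (intro mult_left_mono power_le_one) auto
  then show ?thesis
    using assms by (simp add: norm_mult norm_power)
qed

lemma one_minus_mult_power_nonzero:
  fixes a q :: complex
  assumes "norm a < 1" "norm q < 1"
  shows "1 - a * q ^ i \<noteq> 0"
  using norm_mult_power_less_1[OF assms, of i] by auto

lemma fpoch_nonzero:
  assumes "norm a < 1" "norm q < 1"
  shows "fpoch a q n \<noteq> 0"
  using one_minus_mult_power_nonzero[OF assms] by (simp add: fpoch_def)

lemma qbinom_0 [simp]: "norm q < 1 \<Longrightarrow> qbinom q n 0 = 1"
  by (simp add: qbinom_def fpoch_nonzero)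

text \<open>One form of the q-Pascal rule. With \<open>x = q ^ k\<close>, \<open>y = q ^ d\<close>
  and \<open>n = Suc k + d\<close>, clearing denominators leaves
  \<open>1 - q * q * x * y = q * x * (1 - q * y) + (1 - q * x)\<close>.\<close>

lemma qbinom_Suc:
  assumes q: "norm q < 1"
  shows "qbinom q (Suc n) (Suc k) = q ^ Suc k * qbinom q n (Suc k) + qbinom q n k"
proof -
  have nz: "fpoch q q m \<noteq> 0" for m
    using fpoch_nonzero q by blast
  have nz': "1 - q * q ^ m \<noteq> 0" for m
    using one_minus_mult_power_nonzero[OF q q] .
  consider "Suc k \<le> n" | "k = n" | "k > n" by linarith
  then show ?thesis
  proof cases
    case 1
    then obtain d where d: "n = Suc k + d"
      using le_Suc_ex by blast
    have "Suc n - Suc k = Suc d" "n - Suc k = d" "n - k = Suc d"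
      using d by auto
    moreover have "N * (1 - q * (q * x * y)) / (A * (1 - q * x) * (B * (1 - q * y)))
        = q * x * (N / (A * (1 - q * x) * B)) + N / (A * (B * (1 - q * y)))"
      if "A \<noteq> 0" "B \<noteq> 0" "1 - q * x \<noteq> 0" "1 - q * y \<noteq> 0" for N A B x y
      using that by (simp add: divide_simps) (simp add: algebra_simps)
    then have "fpoch q q n * (1 - q * (q * q ^ k * q ^ d))
          / (fpoch q q k * (1 - q * q ^ k) * (fpoch q q d * (1 - q * q ^ d)))
        = q * q ^ k * (fpoch q q n / (fpoch q q k * (1 - q * q ^ k) * fpoch q q d))
          + fpoch q q n / (fpoch q q k * (fpoch q q d * (1 - q * q ^ d)))"
      using nz nz' by blast
    ultimately show ?thesis
      using 1 by (simp add: qbinom_def fpoch_Suc[of q q "Suc (k + d)"] fpoch_Suc[of q q k] fpoch_Suc[of q q d] d power_add mult_ac)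
  next
    case 2
    then show ?thesis
      using nz by (simp add: qbinom_def)
  next
    case 3
    then show ?thesis
      by (simp add: qbinom_def)
  qed
qed

lemma qbinom_eq_0: "n < k \<Longrightarrow> qbinom q n k = 0"
  by (simp add: qbinom_def)

text \<open>The q-Pascal rule moved onto the weights. It drives all the finite identities below:
  each induction step only has to show that \<open>q ^ k * f k + f (Suc k)\<close> is a constant
  times the weight at shifted parameters.\<close>

lemma sum_qbinom_Suc:
  assumes q: "norm q < 1"
  shows "(\<Sum>k\<le>Suc n. qbinom q (Suc n) k * f k)
       = (\<Sum>k\<le>n. qbinom q n k * (q ^ k * f k + f (Suc k)))"
proof -
  have "(\<Sum>k\<le>Suc n. qbinom q (Suc n) k * f k)
      = f 0 + (\<Sum>k\<le>n. q ^ Suc k * qbinom q n (Suc k) * f (Suc k)) + (\<Sum>k\<le>n. qbinom q n k * f (Suc k))"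
    using q by (simp add: sum.atMost_Suc_shift qbinom_Suc distrib_right sum.distrib del: sum.atMost_Suc)
  \<comment> \<open>\<open>f 0\<close> is the missing term \<open>k = 0\<close>, as
    \<open>qbinom q n 0 = 1\<close>; the new top term vanishes.\<close>
  also have "f 0 + (\<Sum>k\<le>n. q ^ Suc k * qbinom q n (Suc k) * f (Suc k))
      = (\<Sum>k\<le>Suc n. q ^ k * qbinom q n k * f k)"
    using q by (simp add: sum.atMost_Suc_shift del: sum.atMost_Suc)
  also have "\<dots> = (\<Sum>k\<le>n. q ^ k * qbinom q n k * f k)"
    by (simp add: qbinom_eq_0)
  finally show ?thesis
    by (simp add: sum.distrib algebra_simps)
qed

subsection \<open>Finite identities\<close>

text \<open>Finite q-binomial theorem. The combined weight is \<open>1 + x\<close> times the weight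
  for \<open>x * q\<close>, matching the removal of the first factor of the product; hence
  \<open>x\<close> is generalised in the induction.\<close>

lemma Rothe:
  assumes q: "norm q < 1"
  shows "(\<Sum>k\<le>n. qbinom q n k * (q ^ (k * (k - 1) div 2) * x ^ k)) = fpoch (- x) q n"
proof (induction n arbitrary: x)
  case 0
  then show ?case using q by simp
next
  case (Suc n)
  have tri: "Suc k * k div 2 = k * (k - 1) div 2 + k" for k
    by (induction k) (auto simp: algebra_simps)
  have "(\<Sum>k\<le>Suc n. qbinom q (Suc n) k * (q ^ (k * (k - 1) div 2) * x ^ k))
      = (\<Sum>k\<le>n. (1 + x) * (qbinom q n k * (q ^ (k * (k - 1) div 2) * (x * q) ^ k)))"
    unfolding sum_qbinom_Suc[OF q]
  proof (rule sum.cong[OF refl])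
    fix k
    show "qbinom q n k * (q ^ k * (q ^ (k * (k - 1) div 2) * x ^ k)
            + q ^ (Suc k * (Suc k - 1) div 2) * x ^ Suc k)
        = (1 + x) * (qbinom q n k * (q ^ (k * (k - 1) div 2) * (x * q) ^ k))"
      unfolding diff_Suc_1 tri by (simp add: power_add power_mult_distrib algebra_simps)
  qed
  also have "\<dots> = (1 + x) * fpoch (- (x * q)) q n"
    by (simp only: sum_distrib_left[symmetric] Suc)
  finally show ?case
    by (simp add: fpoch_Suc_shift)
qed

text \<open>With \<open>x = c * q ^ k\<close> the two terms are \<open>A / B\<close> and
  \<open>A * x / (B * (1 - x))\<close>, which add up to \<open>A / (B * (1 - x))\<close>; the
  denominator is then regrouped by removing the first instead of the last factor of the
  product.\<close>

lemma q_Vandermonde_summand: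
  assumes q: "norm q < 1" and c: "norm c < 1"
  shows "q ^ k * (q ^ (k * (k - 1)) * c ^ k / fpoch c q k)
      + q ^ (Suc k * (Suc k - 1)) * c ^ Suc k / fpoch c q (Suc k)
    = 1 / (1 - c) * (q ^ (k * (k - 1)) * (c * q) ^ k / fpoch (c * q) q k)"
proof -
  define A where "A = q ^ (k * (k - 1)) * c ^ k * q ^ k"
  define B where "B = fpoch c q k"
  define x where "x = c * q ^ k"
  have nz: "B \<noteq> 0" "1 - x \<noteq> 0"
    unfolding B_def x_def by (rule fpoch_nonzero[OF c q], rule one_minus_mult_power_nonzero[OF c q])
  have e: "Suc k * (Suc k - 1) = k * (k - 1) + k + k"
    by (cases k) simp_all
  have f: "(1 - c) * fpoch (c * q) q k = B * (1 - x)"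
    by (simp only: fpoch_Suc_shift[symmetric] fpoch_Suc B_def x_def)
  have "q ^ k * (q ^ (k * (k - 1)) * c ^ k / fpoch c q k) = A / B"
    by (simp add: A_def B_def)
  moreover have "q ^ (Suc k * (Suc k - 1)) * c ^ Suc k / fpoch c q (Suc k) = A * x / (B * (1 - x))"
    unfolding e by (simp add: fpoch_Suc A_def B_def x_def power_add)
  moreover have "A / B + A * x / (B * (1 - x)) = A / (B * (1 - x))"
    using nz by (simp add: add_divide_eq_iff right_diff_distrib)
  moreover have "1 / (1 - c) * (q ^ (k * (k - 1)) * (c * q) ^ k / fpoch (c * q) q k) = A / (B * (1 - x))"
    by (simp add: A_def power_mult_distrib flip: f)
  ultimately show ?thesis
    by simp
qed

text \<open>The q-Chu-Vandermonde sum with its free numerator parameter sent to infinity, proved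
  directly: each step replaces \<open>c\<close> by \<open>c * q\<close>, which preserves
  \<open>norm c < 1\<close> and so keeps the denominators nonzero.\<close>

lemma q_Vandermonde_limit:
  assumes q: "norm q < 1" and c: "norm c < 1"
  shows "(\<Sum>k\<le>n. qbinom q n k * (q ^ (k * (k - 1)) * c ^ k / fpoch c q k)) = 1 / fpoch c q n"
  using c
proof (induction n arbitrary: c)
  case 0
  then show ?case using q by simp
next
  case (Suc n)
  have cq: "norm (c * q) < 1"
    using norm_mult_power_less_1[OF Suc.prems q, of 1] by simp
  have "(\<Sum>k\<le>Suc n. qbinom q (Suc n) k * (q ^ (k * (k - 1)) * c ^ k / fpoch c q k))
      = 1 / (1 - c) * (\<Sum>k\<le>n. qbinom q n k * (q ^ (k * (k - 1)) * (c * q) ^ k / fpoch (c * q) q k))"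
    by (simp only: sum_qbinom_Suc[OF q] q_Vandermonde_summand[OF q Suc.prems]
        sum_distrib_left mult.left_commute)
  also have "\<dots> = 1 / (1 - c) * (1 / fpoch (c * q) q n)"
    by (simp only: Suc.IH[OF cq])
  finally show ?case
    by (simp add: fpoch_Suc_shift)
qed

section \<open>Theta exponents and the finite triple product\<close>

lemma tri_Suc_int: "(n + 1) * (n + 1 + 1) div 2 = n * (n + 1) div 2 + (n + 1)" for n :: int
proof -
  have "(n + 1) * (n + 1 + 1) = n * (n + 1) + (n + 1) * 2"
    by (simp add: algebra_simps)
  then show ?thesis by simp
qed

lemma tri_nonneg_int: "0 \<le> n * (n + 1) div 2" for n :: int
proof (cases "n \<ge> 0")
  case False
  then have "0 \<le> (- n) * (- (n + 1))" by (intro mult_nonneg_nonneg) auto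
  then show ?thesis by (simp add: algebra_simps)
qed auto

text \<open>Formally, consecutive theta terms have ratio \<open>a ^ n * b ^ (n + 1)\<close>. Since
  \<open>n\<close> may be negative, the relation is cross-multiplied so that only natural exponents
  occur.\<close>

lemma theta_term_step:
  assumes "int k = int r + 1 + n"
  shows "(a * b) ^ k * theta_term a b n = a * (a * b) ^ r * theta_term a b (n + 1)"
proof -
  define T where "T = n * (n + 1) div 2"
  define S where "S = n * (n - 1) div 2"
  have T: "T = S + n"
    using tri_Suc_int[of "n - 1"] by (simp add: T_def S_def algebra_simps)
  have S0: "S \<ge> 0" 
    using tri_nonneg_int[of "n - 1"] by (simp add: S_def algebra_simps)
  have T0: "T \<ge> 0" 
    using tri_nonneg_int[of "n"] by (simp add: T_def algebra_simps)
  have L: "theta_term a b n = a ^ nat S * b ^ nat T"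
    by (simp add: theta_term_def T_def S_def)
  have R: "theta_term a b (n + 1) = a ^ nat T * b ^ nat (T + n + 1)"
    using tri_Suc_int[of n] by (simp add: theta_term_def T_def algebra_simps)
  have T1: "T + n + 1 \<ge> 0"
    using tri_nonneg_int[of "n + 1"] tri_Suc_int[of n] by (simp add: T_def)
  have "k + nat T = r + nat (T + n + 1)" "k + nat S = Suc (r + nat T)"
    using assms T S0 T0 T1 by linarith+
  then have "b ^ (k + nat T) * a ^ (k + nat S) = b ^ (r + nat (T + n + 1)) * a ^ Suc (r + nat T)"
    by simp
  then show ?thesis
    unfolding L R by (simp add: power_add power_mult_distrib mult_ac)
qed

text \<open>Inducting on the first product avoids the substitution of
  a negative power of the base into Rothe's identity; so \<open>a * b = 0\<close> needs no separate treatment.\<close>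

lemma finite_Jacobi_triple:
  assumes q: "norm (a * b) < 1"
  shows "(\<Sum>k\<le>r + s. qbinom (a * b) (r + s) k * theta_term a b (int k - int r))
       = fpoch (- a) (a * b) r * fpoch (- b) (a * b) s"
proof (induction r)
  case 0
  \<comment> \<open>For \<open>r = 0\<close> no negative index occurs, and the theta term is Rothe's
    weight for base \<open>a * b\<close> and argument \<open>b\<close>.\<close>
  have "theta_term a b (int k) = (a * b) ^ (k * (k - 1) div 2) * b ^ k" for k
  proof -
    have S: "int k * (int k - 1) div 2 = int (k * (k - 1) div 2)"
      by (cases k) (simp_all add: zdiv_int algebra_simps)
    have T: "int k * (int k + 1) div 2 = int (k * (k - 1) div 2 + k)"
      using tri_Suc_int[of "int k - 1"] S by (simp add: algebra_simps)
    show ?thesis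
      unfolding theta_term_def S T nat_int by (simp add: power_add power_mult_distrib mult_ac)
  qed
  then show ?case
    using Rothe[OF q, of s b] by simp
next
  case (Suc r)
  have "(\<Sum>k\<le>Suc (r + s). qbinom (a * b) (Suc (r + s)) k * theta_term a b (int k - int (Suc r)))
      = (\<Sum>k\<le>r + s. (1 + a * (a * b) ^ r) * (qbinom (a * b) (r + s) k * theta_term a b (int k - int r)))"
    unfolding sum_qbinom_Suc[OF q]
  proof (rule sum.cong[OF refl])
    fix k
    \<comment> \<open>This turns both parts of the combined weight into multiples of the theta term
      at index \<open>k - r\<close>; the factor \<open>1 + a * (a * b) ^ r\<close> is the new last
      factor of the first product.\<close>
    have "(a * b) ^ k * theta_term a b (int k - int (Suc r)) 
        = a * (a * b) ^ r * theta_term a b (int k - int (Suc r) + 1)"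
      by (rule theta_term_step) simp
    then show "qbinom (a * b) (r + s) k * ((a * b) ^ k * theta_term a b (int k - int (Suc r))
          + theta_term a b (int (Suc k) - int (Suc r)))
        = (1 + a * (a * b) ^ r) * (qbinom (a * b) (r + s) k * theta_term a b (int k - int r))"
      by (simp add: algebra_simps)
  qed
  also have "\<dots> = (1 + a * (a * b) ^ r) * (fpoch (- a) (a * b) r * fpoch (- b) (a * b) s)"
    by (simp only: sum_distrib_left[symmetric] Suc)
  finally show ?case
    by (simp add: fpoch_Suc)
qed

subsection \<open>Infinite products and the Jacobi triple product\<close>

lemma fpoch_convergent_prod:
  fixes a q :: complex
  assumes q: "norm q < 1"
  shows "convergent_prod (\<lambda>i. 1 - a * q ^ i)"
proof -
  have "summable (\<lambda>i. norm ((1 - a * q ^ i) - 1))"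
    using q by (simp add: norm_mult norm_power summable_mult summable_geometric)
  then show ?thesis
    by (intro abs_convergent_prod_imp_convergent_prod summable_imp_abs_convergent_prod)
qed

lemma tendsto_fpoch: "norm q < 1 \<Longrightarrow> fpoch a q \<longlonglongrightarrow> qpoch_inf a q"
  using convergent_prod_LIMSEQ[OF fpoch_convergent_prod, of q a]
    LIMSEQ_lessThan_iff_atMost[of "\<lambda>A. \<Prod>i\<in>A. 1 - a * q ^ i" "qpoch_inf a q"]
  unfolding fpoch_def qpoch_inf_def by blast

lemma qpoch_inf_nonzero:
  assumes "norm a < 1" "norm q < 1"
  shows "qpoch_inf a q \<noteq> 0"
  unfolding qpoch_inf_def
  using prodinf_nonzero[OF fpoch_convergent_prod] one_minus_mult_power_nonzero assms by blast

lemma qpoch_inf_split: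
  assumes q: "norm q < 1"
  shows "qpoch_inf a q = fpoch a q n * qpoch_inf (a * q ^ n) q"
proof -
  have "fpoch a q (n + m) = fpoch a q n * fpoch (a * q ^ n) q m" for m
    by (induction m) (simp_all add: fpoch_Suc power_add mult_ac)
  then have "(\<lambda>m. fpoch a q (n + m)) \<longlonglongrightarrow> fpoch a q n * qpoch_inf (a * q ^ n) q"
    using tendsto_mult_left[OF tendsto_fpoch[OF q]] by simp
  moreover have "(\<lambda>m. fpoch a q (n + m)) \<longlonglongrightarrow> qpoch_inf a q"
    using LIMSEQ_ignore_initial_segment[OF tendsto_fpoch[OF q, of a], of n] by (simp add: add.commute)
  ultimately show ?thesis
    using LIMSEQ_unique by blast
qed

text \<open>Links the quotient definition to the finite product: \<open>norm a < 1\<close> makes the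
  infinite product in the denominator nonzero, so it cancels.\<close>

lemma qpoch_eq_fpoch:
  assumes "norm a < 1" "norm q < 1"
  shows "qpoch a q n = fpoch a q n"
  using qpoch_inf_split[OF assms(2), of a n] norm_mult_power_less_1[OF assms, of n]
    qpoch_inf_nonzero[of "a * q ^ n" q] assms(2)
  by (simp add: qpoch_def)

lemma qpoch_inf_even:
  assumes q: "norm q < 1"
  shows "qpoch_inf a q = qpoch_inf a (q\<^sup>2) * qpoch_inf (a * q) (q\<^sup>2)"
proof -
  have q2: "norm (q\<^sup>2) < 1"
    using q norm_mult_power_less_1[OF q q, of 1] by (simp add: power2_eq_square)
  have "strict_mono (\<lambda>n::nat. 2 * n)"
    by (simp add: strict_mono_def)
  then have "(\<lambda>n. fpoch a q (2 * n)) \<longlonglongrightarrow> qpoch_inf a q"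
    using LIMSEQ_subseq_LIMSEQ[OF tendsto_fpoch[OF q]] by (auto simp: o_def)
  moreover have "(\<lambda>n. fpoch a q (2 * n)) \<longlonglongrightarrow> qpoch_inf a (q\<^sup>2) * qpoch_inf (a * q) (q\<^sup>2)"
    unfolding fpoch_even by (intro tendsto_mult tendsto_fpoch q2)
  ultimately show ?thesis
    using LIMSEQ_unique by blast
qed

section \<open>Uniform bounds and Euler's series\<close>

text \<open>The products converge to a nonzero limit, so their reciprocals converge and are
  bounded.\<close>

lemma inverse_fpoch_bound:
  assumes a: "norm a < 1" and q: "norm q < 1"
  obtains C where "C > 0" "\<And>n. norm (1 / fpoch a q n) \<le> C"
proof -
  have "(\<lambda>n. 1 / fpoch a q n) \<longlonglongrightarrow> 1 / qpoch_inf a q"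
    by (intro tendsto_divide tendsto_const tendsto_fpoch a q qpoch_inf_nonzero)
  then have "Bseq (\<lambda>n. 1 / fpoch a q n)"
    using convergentI convergent_imp_Bseq by blast
  then show thesis
    using that unfolding Bseq_def by blast
qed

text \<open>The bound is uniform in both \<open>n\<close> and \<open>k\<close>, which supplies the
  majorants for Tannery's theorem.\<close>

lemma qbinom_bound:
  assumes q: "norm q < 1"
  obtains C where "C > 0" "\<And>n k. norm (qbinom q n k) \<le> C"
proof -
  obtain C where C: "C > 0" "\<And>n. norm (1 / fpoch q q n) \<le> C"
    using inverse_fpoch_bound[OF q q] by blast
  have "Bseq (fpoch q q)"
    using convergentI convergent_imp_Bseq tendsto_fpoch[OF q] by blast
  then obtain D where D: "D > 0" "\<And>n. norm (fpoch q q n) \<le> D"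
    unfolding Bseq_def by blast
  have "norm (qbinom q n k) \<le> D * (C * C)" for n k
  proof (cases "k \<le> n")
    case True
    have "norm (qbinom q n k)
        = norm (fpoch q q n) * (norm (1 / fpoch q q k) * norm (1 / fpoch q q (n - k)))"
      using True by (simp add: qbinom_def norm_divide norm_mult)
    also have "\<dots> \<le> D * (C * C)"
      using C D by (intro mult_mono) (auto intro: less_imp_le)
    finally show ?thesis .
  qed (use C D in \<open>simp add: qbinom_def\<close>)
  then show thesis
    using that[of "D * (C * C)"] C D by simp
qed

text \<open>Rothe's identity as \<open>n\<close> tends to infinity. Bounding the power of
  \<open>q\<close> by 1 leaves the majorant \<open>C * norm x ^ k\<close>.\<close>

lemma sums_Euler:
  assumes q: "norm q < 1" and x: "norm x < 1"
  shows "(\<lambda>k. q ^ (k * (k - 1) div 2) * x ^ k / fpoch q q k) sums qpoch_inf (- x) q"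
    and "summable (\<lambda>k. norm (q ^ (k * (k - 1) div 2) * x ^ k / fpoch q q k))"
proof -
  define a where "a = (\<lambda>k n. qbinom q n k * (q ^ (k * (k - 1) div 2) * x ^ k))"
  define b where "b = (\<lambda>k. q ^ (k * (k - 1) div 2) * x ^ k / fpoch q q k)"
  obtain C where C: "C > 0" "\<And>n k. norm (qbinom q n k) \<le> C"
    using qbinom_bound[OF q] by blast
  have lim: "(\<lambda>n. qbinom q n k) \<longlonglongrightarrow> 1 / fpoch q q k" for k
  proof -
    \<comment> \<open>The index is shifted by \<open>k\<close> so that the nonzero branch of
      \<open>qbinom\<close> always applies.\<close>
    have "(\<lambda>n. fpoch q q (n + k) / (fpoch q q k * fpoch q q n)) 
        \<longlonglongrightarrow> qpoch_inf q q / (fpoch q q k * qpoch_inf q q)"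
      using q by (intro tendsto_intros LIMSEQ_ignore_initial_segment tendsto_fpoch)
        (simp_all add: fpoch_nonzero qpoch_inf_nonzero)
    then have "(\<lambda>n. qbinom q (n + k) k) \<longlonglongrightarrow> 1 / fpoch q q k"
      using qpoch_inf_nonzero[OF q q] by (simp add: qbinom_def)
    then show ?thesis
      by (rule LIMSEQ_offset)
  qed
  have "norm (a k n) \<le> C * norm x ^ k" for k n
  proof -
    have "norm (a k n) = norm (qbinom q n k) * (norm q ^ (k * (k - 1) div 2) * norm x ^ k)"
      by (simp add: a_def norm_mult norm_power)
    also have "\<dots> \<le> C * (1 * norm x ^ k)"
      using C q by (intro mult_mono power_le_one) auto
    finally show ?thesis by simp
  qed
  then have "eventually (\<lambda>(k,n). norm (a k n) \<le> C * norm x ^ k) (at_top \<times>\<^sub>F at_top)"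
    by (intro always_eventually) auto
  moreover have "(a k) \<longlonglongrightarrow> b k" for k
    using tendsto_mult[OF lim[of k] tendsto_const[of "q ^ (k * (k - 1) div 2) * x ^ k"]]
    by (simp add: a_def b_def)
  moreover have "summable (\<lambda>k. C * norm x ^ k)"
    using x by (intro summable_mult summable_geometric) simp
  ultimately have T: "summable (\<lambda>k. norm (b k))" "(\<lambda>n. suminf (\<lambda>k. a k n)) \<longlonglongrightarrow> suminf b"
    using tannerys_theorem[of a b sequentially "\<lambda>k. C * norm x ^ k"] by auto
  have "suminf (\<lambda>k. a k n) = fpoch (- x) q n" for n
  proof -
    have "suminf (\<lambda>k. a k n) = (\<Sum>k\<le>n. a k n)"
      by (rule suminf_finite) (auto simp: a_def qbinom_eq_0)
    then show ?thesis
      using Rothe[OF q] by (simp add: a_def)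
  qed
  then have "suminf b = qpoch_inf (- x) q"
    using T(2) tendsto_fpoch[OF q, of "-x"] LIMSEQ_unique by simp
  then show "b sums qpoch_inf (- x) q"
    using T(1) summable_norm_cancel summable_sums by metis
  show "summable (\<lambda>k. norm (b k))" by fact
qed

section \<open>The Jacobi triple product\<close>

text \<open>The two exponents are nonnegative and differ by \<open>n\<close>, so their sum is at
  least the absolute value of \<open>n\<close>; a two-sided geometric series dominates.\<close>

lemma theta_term_abs_summable:
  assumes a: "norm a < 1" and b: "norm b < 1"
  shows "(\<lambda>n. norm (theta_term a b n)) summable_on UNIV"
proof -
  define r where "r = max (norm a) (norm b)"
  have r: "0 \<le> r" "r < 1" "norm a \<le> r" "norm b \<le> r"
    using a b by (auto simp: r_def le_max_iff_disj)
  have geom: "(\<lambda>n. r ^ n) summable_on (UNIV :: nat set)"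
    using r by (intro norm_summable_imp_summable_on) (simp add: summable_geometric)
  have "(\<lambda>n. r ^ nat \<bar>n\<bar>) summable_on ({0..} \<union> {..0::int})"
  proof (rule summable_on_union)
    show "(\<lambda>n. r ^ nat \<bar>n\<bar>) summable_on {0::int..}"
    proof -
      have "bij_betw int UNIV {0..}"
        by (rule bij_betw_byWitness[of _ nat]) auto
      from summable_on_reindex_bij_betw[OF this, of "\<lambda>n. r ^ nat \<bar>n\<bar>"] show ?thesis
        using geom by simp
    qed
    show "(\<lambda>n. r ^ nat \<bar>n\<bar>) summable_on {..0::int}"
    proof -
      have "bij_betw (\<lambda>n. - int n) UNIV {..0}"
        by (rule bij_betw_byWitness[of _ "\<lambda>n. nat (- n)"]) auto
      from summable_on_reindex_bij_betw[OF this, of "\<lambda>n. r ^ nat \<bar>n\<bar>"] show ?thesis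
        using geom by simp
    qed
  qed
  moreover have "{0..} \<union> {..0::int} = UNIV" by auto
  ultimately have S: "(\<lambda>n::int. r ^ nat \<bar>n\<bar>) summable_on UNIV" by simp
  show ?thesis
  proof (rule Infinite_Sum.abs_summable_on_comparison_test'[OF S])
    fix n :: int
    define T where "T = n * (n + 1) div 2"
    define U where "U = n * (n - 1) div 2"
    have TU: "T = U + n"
      using tri_Suc_int[of "n - 1"] by (simp add: T_def U_def algebra_simps)
    have T0: "T \<ge> 0" "U \<ge> 0"
      using tri_nonneg_int[of "n - 1"] tri_nonneg_int[of "n"] by (simp_all add: T_def U_def algebra_simps)
    have "norm (theta_term a b n) = norm a ^ nat U * norm b ^ nat T"
      by (simp add: theta_term_def T_def U_def norm_mult norm_power)
    also have "\<dots> \<le> r ^ nat U * r ^ nat T"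
      using r by (intro mult_mono power_mono) auto
    also have "\<dots> = r ^ (nat U + nat T)"
      by (simp add: power_add)
    also have "\<dots> \<le> r ^ nat \<bar>n\<bar>"
      using r TU T0 by (intro power_decreasing) auto
    finally show "norm (theta_term a b n) \<le> r ^ nat \<bar>n\<bar>" .
  qed
qed

text \<open>The finite identity with \<open>r = s = N\<close>, as \<open>N\<close> grows. Every
  coefficient tends to \<open>1 / qpoch_inf p p\<close>, and \<open>int_decode\<close> turns the
  bilateral sum into a series over the naturals for Tannery's theorem.\<close>

lemma Jacobi_triple:
  assumes a: "norm a < 1" and b: "norm b < 1"
  shows "(theta_term a b has_sum
      (qpoch_inf (a * b) (a * b) * qpoch_inf (- a) (a * b) * qpoch_inf (- b) (a * b))) UNIV"
proof -
  define p where "p = a * b"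
  have p: "norm p < 1"
    using norm_mult_power_less_1[OF a b, of 1] by (simp add: p_def)
  have P: "qpoch_inf p p \<noteq> 0"
    using qpoch_inf_nonzero p by blast
  \<comment> \<open>The coefficient of the theta term at \<open>n = k - N\<close>, extended by zero.
    Without the guard, \<open>nat\<close> would send each \<open>n < - N\<close> to the index 0,
    where the coefficient is 1.\<close>
  define c where "c = (\<lambda>n N. if \<bar>n\<bar> \<le> int N then qbinom p (N + N) (nat (n + int N)) else 0)"
  obtain C where C: "C > 0" "\<And>n k. norm (qbinom p n k) \<le> C"
    using qbinom_bound[OF p] by blast
  have cC: "norm (c n N) \<le> C" for n N
    using C by (simp add: c_def less_imp_le)
  have clim: "(\<lambda>N. c n N) \<longlonglongrightarrow> 1 / qpoch_inf p p" for n
  proof -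
    have f1: "filterlim (\<lambda>N::nat. N + N) sequentially sequentially"
      by (rule filterlim_subseq) (simp add: strict_mono_def)
    have f2: "filterlim (\<lambda>N. nat (m + int N)) sequentially sequentially" for m
      unfolding filterlim_at_top eventually_sequentially
    proof 
      fix Z
      show "\<exists>N. \<forall>n\<ge>N. Z \<le> nat (m + int n)"
        by (rule exI[of _ "Z + nat \<bar>m\<bar>"]) auto
    qed
    note L = filterlim_compose[OF tendsto_fpoch[OF p, of p]]
    \<comment> \<open>All three lengths \<open>2N\<close>, \<open>N + n\<close> and
      \<open>N - n\<close> tend to infinity; for large \<open>N\<close> the conversions to
      \<open>nat\<close> are exact.\<close>
    have "(\<lambda>N. fpoch p p (N + N) / (fpoch p p (nat (n + int N)) * fpoch p p (nat (- n + int N))))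
        \<longlonglongrightarrow> qpoch_inf p p / (qpoch_inf p p * qpoch_inf p p)"
      using P by (intro tendsto_divide tendsto_mult L f1 f2) auto
    moreover have "eventually (\<lambda>N. fpoch p p (N + N) / (fpoch p p (nat (n + int N)) * fpoch p p (nat (- n + int N)))
        = c n N) sequentially"
    proof (rule eventually_sequentiallyI[of "nat \<bar>n\<bar>"])
      fix N assume "nat \<bar>n\<bar> \<le> N"
      then have "\<bar>n\<bar> \<le> int N" "nat (n + int N) \<le> N + N" "N + N - nat (n + int N) = nat (- n + int N)"
        by linarith+
      then show "fpoch p p (N + N) / (fpoch p p (nat (n + int N)) * fpoch p p (nat (- n + int N))) = c n N"
        by (simp add: c_def qbinom_def)
    qed
    ultimately show ?thesis
      using P Lim_transform_eventually by fastforce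
  qed
  define t where "t = theta_term a b"
  have tsum: "summable (\<lambda>m. norm (t (int_decode m)))"
    using theta_term_abs_summable[OF a b] summable_on_reindex_bij_betw[OF bij_int_decode, of "\<lambda>n. norm (t n)"]
    by (auto intro: summable_on_imp_summable simp: t_def)
  define A where "A = (\<lambda>m N. c (int_decode m) N * t (int_decode m))"
  have bd: "norm (A m N) \<le> C * norm (t (int_decode m))" for m N
    using cC by (simp add: A_def norm_mult mult_right_mono)
  have "A m \<longlonglongrightarrow> 1 / qpoch_inf p p * t (int_decode m)" for m
    unfolding A_def by (intro tendsto_mult clim tendsto_const)
  moreover have "eventually (\<lambda>(m,N). norm (A m N) \<le> C * norm (t (int_decode m))) (at_top \<times>\<^sub>F at_top)"
    using bd by (intro always_eventually) auto
  ultimately have "(\<lambda>N. suminf (\<lambda>m. A m N)) \<longlonglongrightarrow> suminf (\<lambda>m. 1 / qpoch_inf p p * t (int_decode m))"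
    using tannerys_theorem[of A "\<lambda>m. 1 / qpoch_inf p p * t (int_decode m)" sequentially "\<lambda>m. C * norm (t (int_decode m))"]
      summable_mult[OF tsum, of C] by simp
  moreover have "suminf (\<lambda>m. A m N) = fpoch (- a) p N * fpoch (- b) p N" for N
  proof -
    have "(\<Sum>n\<in>{- int N..int N}. c n N * t n) = (\<Sum>k\<le>N + N. qbinom p (N + N) k * t (int k - int N))"
      by (rule sum.reindex_bij_witness[of _ "\<lambda>k. int k - int N" "\<lambda>n. nat (n + int N)"])
        (auto simp: c_def)
    also have "\<dots> = fpoch (- a) p N * fpoch (- b) p N"
      using finite_Jacobi_triple[of a b N N] p by (simp add: p_def t_def)
    finally have e: "(\<Sum>n\<in>{- int N..int N}. c n N * t n) = fpoch (- a) p N * fpoch (- b) p N" .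
    have "((\<lambda>n. c n N * t n) has_sum (\<Sum>n\<in>{- int N..int N}. c n N * t n)) {- int N..int N}"
      by (rule has_sum_finite) simp
    \<comment> \<open>\<open>c\<close> vanishes outside the window, so the finite sum is also the
      sum over all integers.\<close>
    moreover have "((\<lambda>n. c n N * t n) has_sum S) {- int N..int N} \<longleftrightarrow> ((\<lambda>n. c n N * t n) has_sum S) UNIV" for S
      by (rule has_sum_cong_neutral) (auto simp: c_def)
    ultimately have "((\<lambda>n. c n N * t n) has_sum (\<Sum>n\<in>{- int N..int N}. c n N * t n)) UNIV"
      by blast
    then have "((\<lambda>m. A m N) has_sum (\<Sum>n\<in>{- int N..int N}. c n N * t n)) UNIV"
      unfolding A_def using has_sum_reindex_bij_betw[OF bij_int_decode, of "\<lambda>n. c n N * t n"] by simp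
    then show ?thesis
      using has_sum_imp_sums e sums_unique by metis
  qed
  ultimately have "suminf (\<lambda>m. 1 / qpoch_inf p p * t (int_decode m)) = qpoch_inf (- a) p * qpoch_inf (- b) p"
    using LIMSEQ_unique tendsto_mult[OF tendsto_fpoch[OF p, of "-a"] tendsto_fpoch[OF p, of "-b"]] by simp
  then have "suminf (\<lambda>m. t (int_decode m)) = qpoch_inf p p * qpoch_inf (- a) p * qpoch_inf (- b) p"
    using P suminf_mult[OF summable_norm_cancel[OF tsum], of "1 / qpoch_inf p p"] by (simp add: field_simps)
  then have "(\<lambda>m. t (int_decode m)) sums (qpoch_inf p p * qpoch_inf (- a) p * qpoch_inf (- b) p)"
    using summable_norm_cancel[OF tsum] summable_sums by metis
  then have "((\<lambda>m. t (int_decode m)) has_sum (qpoch_inf p p * qpoch_inf (- a) p * qpoch_inf (- b) p)) UNIV"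
    by (rule norm_summable_imp_has_sum[OF tsum])
  then show ?thesis
    using has_sum_reindex_bij_betw[OF bij_int_decode, of t] by (simp add: t_def p_def)
qed

subsection \<open>Slater's identities and the double sums\<close>

lemma summable_on_geometric_bound:
  fixes f :: "nat \<Rightarrow> complex"
  assumes "\<And>n. norm (f n) \<le> K * r ^ n" "0 \<le> r" "r < 1"
  shows "f summable_on UNIV"
proof (rule norm_summable_imp_summable_on)
  have "summable (\<lambda>n. K * r ^ n)"
    using assms by (intro summable_mult summable_geometric) simp
  then show "summable (\<lambda>n. norm (f n))"
    by (rule summable_comparison_test'[where N = 0]) (use assms in simp)
qed

lemma has_sum_even_odd_nat:
  fixes f :: "nat \<Rightarrow> 'a :: topological_comm_monoid_add"
  assumes "((\<lambda>n. f (2 * n)) has_sum a) UNIV" "((\<lambda>n. f (2 * n + 1)) has_sum b) UNIV"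
  shows "(f has_sum (a + b)) UNIV"
proof -
  have "(f has_sum a) (range (\<lambda>n. 2 * n))" "(f has_sum b) (range (\<lambda>n. 2 * n + 1))"
    using assms by (subst has_sum_reindex; simp add: inj_on_def o_def)+
  moreover have "range (\<lambda>n::nat. 2 * n) \<inter> range (\<lambda>n. 2 * n + 1) = {}"
    by (auto, presburger)
  moreover have "range (\<lambda>n::nat. 2 * n) \<union> range (\<lambda>n. 2 * n + 1) = UNIV"
    by (auto simp: image_iff, presburger)
  ultimately show ?thesis
    using has_sum_Un_disjoint by metis
qed

lemma has_sum_even_odd_int:
  fixes f :: "int \<Rightarrow> 'a :: topological_comm_monoid_add"
  assumes "((\<lambda>n. f (2 * n)) has_sum a) UNIV" "((\<lambda>n. f (2 * n - 1)) has_sum b) UNIV"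
  shows "(f has_sum (a + b)) UNIV"
proof -
  have "(f has_sum a) (range (\<lambda>n. 2 * n))" "(f has_sum b) (range (\<lambda>n. 2 * n - 1))"
    using assms by (subst has_sum_reindex; simp add: inj_on_def o_def)+
  moreover have "range (\<lambda>n::int. 2 * n) \<inter> range (\<lambda>n. 2 * n - 1) = {}"
    by (auto, presburger)
  moreover have "range (\<lambda>n::int. 2 * n) \<union> range (\<lambda>n. 2 * n - 1) = UNIV"
    by (auto simp: image_iff, presburger)
  ultimately show ?thesis
    using has_sum_Un_disjoint by metis
qed

section \<open>Parity dissection and Slater's identities\<close>

lemma theta_term_power:
  "theta_term (s ^ i) (s ^ j) n = s ^ nat (int i * (n * (n - 1) div 2) + int j * (n * (n + 1) div 2))"
proof -
  define U where "U = n * (n - 1) div 2"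
  define T where "T = n * (n + 1) div 2"
  have "U \<ge> 0" "T \<ge> 0"
    using tri_nonneg_int[of "n - 1"] tri_nonneg_int[of n] by (simp_all add: U_def T_def mult.commute)
  then have "nat (int i * U + int j * T) = i * nat U + j * nat T"
    by (simp add: nat_add_distrib nat_mult_distrib)
  then show ?thesis
    by (simp add: theta_term_def flip: U_def T_def power_mult power_add)
qed

text \<open>The left side is \<open>s ^ (2n^2 + n)\<close>. At \<open>n = 2m\<close> the exponent is
  \<open>8m^2 + 2m\<close>, at \<open>n = 2m - 1\<close> it is \<open>8m^2 - 6m + 1\<close>; these
  give the pairs (6, 10) and (14, 2). Indexing the odd integers by \<open>2m + 1\<close> would
  require a negative power of \<open>s\<close>.\<close>

lemma theta_term_even: "theta_term s (s ^ 3) (2 * m) = theta_term (s ^ 6) (s ^ 10) m"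
  and theta_term_odd: "theta_term s (s ^ 3) (2 * m - 1) = s * theta_term (s ^ 14) (s ^ 2) m"
proof -
  define U where "U = m * (m - 1) div 2"
  have U: "m * m = 2 * U + m"
    by (simp add: U_def algebra_simps)
  have T: "m * (m + 1) div 2 = U + m"
    using tri_Suc_int[of "m - 1"] by (simp add: U_def algebra_simps)
  have U0: "U \<ge> 0" "U + m \<ge> 0"
    using tri_nonneg_int[of "m - 1"] tri_nonneg_int[of m] T by (simp_all add: U_def mult.commute)
  have e: "2 * m * (2 * m - 1) = 2 * (4 * U + m)" "2 * m * (2 * m + 1) = 2 * (4 * U + 3 * m)"
    "(2 * m - 1) * (2 * m - 1 - 1) = 2 * (4 * U - m + 1)" "(2 * m - 1) * (2 * m - 1 + 1) = 2 * (4 * U + m)"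
    using U by (simp_all add: algebra_simps)
  note d = e[THEN arg_cong[where f = "\<lambda>x. x div 2"], unfolded nonzero_mult_div_cancel_left[OF zero_neq_numeral[symmetric]]]
  have p: "theta_term s (s ^ 3) n = theta_term (s ^ 1) (s ^ 3) n" for n
    by simp
  show "theta_term s (s ^ 3) (2 * m) = theta_term (s ^ 6) (s ^ 10) m"
    unfolding p theta_term_power d T U_def[symmetric] by (simp add: algebra_simps)
  have "nat (int 1 * (4 * U - m + 1) + int 3 * (4 * U + m)) = Suc (nat (int 14 * U + int 2 * (U + m)))"
    using U0 by simp
  then show "theta_term s (s ^ 3) (2 * m - 1) = s * theta_term (s ^ 14) (s ^ 2) m"
    unfolding p theta_term_power d T U_def[symmetric] by simp
qed

lemma norm_power_less_1:
  fixes q :: complex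
  assumes "norm q < 1" "n > 0"
  shows "norm (q ^ n) < 1"
  using assms by (simp add: norm_power power_less_one_iff)

text \<open>The four quantities \<open>?E\<close>, \<open>?O\<close>, \<open>?A\<close>,
  \<open>?B\<close> depend on \<open>q\<close> alone. The result holds for either square root
  \<open>s\<close>, which allows the comparison of \<open>s\<close> with \<open>-s\<close>.\<close>

lemma Euler_theta_dissection:
  fixes s q :: complex
  assumes q: "norm q < 1" and s: "s\<^sup>2 = q"
  shows "qpoch_inf (- s) q = (\<Sum>\<^sub>\<infinity>n. q ^ (2 * n\<^sup>2) / fpoch q q (2 * n))
            + s * (\<Sum>\<^sub>\<infinity>n. q ^ (2 * n\<^sup>2 + 2 * n) / fpoch q q (1 + 2 * n))" (is "_ = ?E + s * ?O")
    and "qpoch_inf (q\<^sup>2) (q\<^sup>2) * qpoch_inf (- s) q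
       = qpoch_inf_list [q ^ 8, - (q ^ 3), - (q ^ 5)] (q ^ 8)
         + s * qpoch_inf_list [q ^ 8, - q, - (q ^ 7)] (q ^ 8)" (is "_ = ?A + s * ?B")
    and "(\<lambda>n. q ^ (2 * n\<^sup>2) / fpoch q q (2 * n)) summable_on UNIV"
    and "(\<lambda>n. q ^ (2 * n\<^sup>2 + 2 * n) / fpoch q q (1 + 2 * n)) summable_on UNIV"
proof -
  have ns: "norm s < 1"
    using q norm_power[of s 2] s power_less_one_iff[of "norm s" 2] by simp
  obtain C where C: "C > 0" "\<And>n. norm (1 / fpoch q q n) \<le> C"
    using inverse_fpoch_bound[OF q q] by blast
  have bd: "norm (q ^ i / fpoch q q k) \<le> C * norm q ^ n" if "n \<le> i" for i k n
  proof -
    have "norm (q ^ i / fpoch q q k) = norm (1 / fpoch q q k) * norm q ^ i"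
      by (simp add: norm_divide norm_power)
    also have "\<dots> \<le> C * norm q ^ n"
      using C q that by (intro mult_mono power_decreasing) auto
    finally show ?thesis .
  qed
  show E: "(\<lambda>n. q ^ (2 * n\<^sup>2) / fpoch q q (2 * n)) summable_on UNIV"
    using q by (intro summable_on_geometric_bound[where r = "norm q" and K = C] bd) (auto simp: power2_eq_square)
  show O: "(\<lambda>n. q ^ (2 * n\<^sup>2 + 2 * n) / fpoch q q (1 + 2 * n)) summable_on UNIV"
    using q by (intro summable_on_geometric_bound[where r = "norm q" and K = C] bd) auto
  define f where "f = (\<lambda>k. q ^ (k * (k - 1) div 2) * s ^ k / fpoch q q k)"
  have "f (2 * n) = q ^ (2 * n\<^sup>2) / fpoch q q (2 * n)" for n
  proof -
    have "2 * n * (2 * n - 1) div 2 = n * (2 * n - 1)"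
      by (simp add: mult.assoc)
    moreover have "n * (2 * n - 1) + n = 2 * n\<^sup>2"
      by (cases n) (simp_all add: power2_eq_square algebra_simps)
    moreover have "s ^ (2 * n) = q ^ n"
      by (simp add: s power_mult)
    ultimately show ?thesis
      unfolding f_def by (metis power_add)
  qed
  moreover have "f (2 * n + 1) = s * (q ^ (2 * n\<^sup>2 + 2 * n) / fpoch q q (1 + 2 * n))" for n
  proof -
    \<comment> \<open>At the odd index \<open>2n + 1\<close> the exponent is
      \<open>n * (2n + 1)\<close>, and \<open>s ^ (2n + 1)\<close> contributes \<open>q ^ n\<close>
      and one leftover \<open>s\<close>.\<close>
    have ac: "x * (y * s) / z = s * (x * y / z)" for x y z
      by simp
    have e: "2 * n\<^sup>2 + n + n = 2 * n\<^sup>2 + 2 * n"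
      by linarith
    have "(2 * n + 1) * (2 * n + 1 - 1) = 2 * (2 * n\<^sup>2 + n)"
      by (simp add: power2_eq_square algebra_simps)
    then have "(2 * n + 1) * (2 * n + 1 - 1) div 2 = 2 * n\<^sup>2 + n"
      by simp
    moreover have "s ^ (2 * n + 1) = q ^ n * s"
      by (simp only: power_add power_mult s power_one_right)
    ultimately have "f (2 * n + 1) = q ^ (2 * n\<^sup>2 + n) * (q ^ n * s) / fpoch q q (2 * n + 1)"
      by (simp only: f_def)
    also have "\<dots> = s * (q ^ (2 * n\<^sup>2 + n) * q ^ n / fpoch q q (1 + 2 * n))"
      unfolding add.commute[of 1 "2 * n"] by (rule ac)
    also have "q ^ (2 * n\<^sup>2 + n) * q ^ n = q ^ (2 * n\<^sup>2 + n + n)"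
      by (rule power_add[symmetric])
    also have "2 * n\<^sup>2 + n + n = 2 * n\<^sup>2 + 2 * n"
      by (rule e)
    finally show ?thesis .
  qed
  ultimately have "(f has_sum (?E + s * ?O)) UNIV"
    using has_sum_infsum[OF E] has_sum_cmult_right[OF has_sum_infsum[OF O], of s]
    by (intro has_sum_even_odd_nat) simp_all
  moreover have "(f has_sum qpoch_inf (- s) q) UNIV"
    unfolding f_def by (rule norm_summable_imp_has_sum[OF sums_Euler(2)[OF q ns] sums_Euler(1)[OF q ns]])
  ultimately show "qpoch_inf (- s) q = ?E + s * ?O"
    using has_sum_unique by blast

  have pw: "s ^ 6 = q ^ 3" "s ^ 10 = q ^ 5" "s ^ 14 = q ^ 7" "s ^ 2 = q"
    by (simp_all add: s[symmetric] flip: power_mult)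
  have mm: "q ^ 3 * q ^ 5 = q ^ 8" "q ^ 7 * q = q ^ 8"
    by (simp_all flip: power_add power_Suc2)
  have "norm (q ^ 3) < 1" "norm (q ^ 5) < 1" "norm (q ^ 7) < 1"
    using q by (auto intro: norm_power_less_1)
  note J = Jacobi_triple[OF this(1,2)] Jacobi_triple[OF this(3) q]
  have "(theta_term (s ^ 6) (s ^ 10) has_sum ?A) UNIV"
    using J(1) unfolding pw mm by (simp add: qpoch_inf_list_def mult.assoc)
  moreover have "(theta_term (s ^ 14) (s ^ 2) has_sum ?B) UNIV"
    using J(2) unfolding pw mm by (simp add: qpoch_inf_list_def mult_ac)
  ultimately have "(theta_term s (s ^ 3) has_sum (?A + s * ?B)) UNIV"
    using has_sum_cmult_right by (intro has_sum_even_odd_int) (simp_all add: theta_term_even theta_term_odd)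
  moreover have "(theta_term s (s ^ 3) has_sum (qpoch_inf (q\<^sup>2) (q\<^sup>2) * qpoch_inf (- s) q)) UNIV"
  proof -
    \<comment> \<open>The triple product has base \<open>q\<^sup>2\<close> here, and its factors at
      \<open>-s\<close> and \<open>-s * q\<close> merge into
      \<open>qpoch_inf (- s) q\<close>.\<close>
    have "s * s ^ 3 = q\<^sup>2" "s ^ 3 = s * q"
      by (simp_all add: s[symmetric] power_def)
    then show ?thesis
      using Jacobi_triple[OF ns norm_power_less_1[OF ns, of 3]] qpoch_inf_even[OF q, of "- s"]
      by (simp add: mult.assoc)
  qed
  ultimately show "qpoch_inf (q\<^sup>2) (q\<^sup>2) * qpoch_inf (- s) q = ?A + s * ?B"
    using has_sum_unique by blast
qed

lemma Slater_39:
  assumes q: "norm q < 1"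
  shows "((\<lambda>n. q ^ (2 * n\<^sup>2) / fpoch q q (2 * n)) has_sum
      (qpoch_inf_list [q ^ 8, - (q ^ 3), - (q ^ 5)] (q ^ 8) / qpoch_inf (q\<^sup>2) (q\<^sup>2))) UNIV" (is ?thesis1)
    and Slater_38: "((\<lambda>n. q ^ (2 * n\<^sup>2 + 2 * n) / fpoch q q (1 + 2 * n)) has_sum
      (qpoch_inf_list [q ^ 8, - q, - (q ^ 7)] (q ^ 8) / qpoch_inf (q\<^sup>2) (q\<^sup>2))) UNIV" (is ?thesis2)
proof -
  define t where "t = csqrt q"
  have t: "t\<^sup>2 = q" "(- t)\<^sup>2 = q"
    by (simp_all add: t_def)
  define P where "P = qpoch_inf (q\<^sup>2) (q\<^sup>2)"
  define E where "E = (\<Sum>\<^sub>\<infinity>n. q ^ (2 * n\<^sup>2) / fpoch q q (2 * n))"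
  define F where "F = (\<Sum>\<^sub>\<infinity>n. q ^ (2 * n\<^sup>2 + 2 * n) / fpoch q q (1 + 2 * n))"
  define A where "A = qpoch_inf_list [q ^ 8, - (q ^ 3), - (q ^ 5)] (q ^ 8)"
  define B where "B = qpoch_inf_list [q ^ 8, - q, - (q ^ 7)] (q ^ 8)"
  have P: "P \<noteq> 0"
    unfolding P_def using q by (intro qpoch_inf_nonzero norm_power_less_1) auto
  note D = Euler_theta_dissection[OF q, folded E_def F_def A_def B_def P_def]
  have p: "P * (E + t * F) = A + t * B"
    using D(1,2)[OF t(1)] by simp
  have m: "P * (E - t * F) = A - t * B"
    using D(1,2)[OF t(2)] by simp
  \<comment> \<open>Adding the relations for the two square roots isolates the even part;
    subtracting them below isolates the odd part.\<close>
  have "2 * (P * E) = P * (E + t * F) + P * (E - t * F)" 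
    by (simp add: algebra_simps)
  then have "P * E = A"
    unfolding p m by simp
  then have "E = A / P"
    using P by (simp add: eq_divide_eq mult.commute)
  then show ?thesis1
    using has_sum_infsum[OF D(3)[OF t(1)]] by (simp only: E_def A_def P_def)
  show ?thesis2
  \<comment> \<open>The odd part carries the factor \<open>t\<close>, which cancels only for nonzero
    \<open>q\<close>. At \<open>q = 0\<close> the series reduces to its term \<open>n = 0\<close>,
    and both sides are 1.\<close>
  proof (cases "q = 0")
    case True
    have "((\<lambda>n. q ^ (2 * n\<^sup>2 + 2 * n) / fpoch q q (1 + 2 * n)) has_sum 1) {0}"
      using has_sum_finite[of "{0}" "\<lambda>n. q ^ (2 * n\<^sup>2 + 2 * n) / fpoch q q (1 + 2 * n)"] True
      by (simp add: fpoch_def)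
    then have "((\<lambda>n. q ^ (2 * n\<^sup>2 + 2 * n) / fpoch q q (1 + 2 * n)) has_sum 1) UNIV"
      by (subst has_sum_cong_neutral[of "{0}" UNIV]) (auto simp: True)
    moreover have "qpoch_inf 0 0 = 1"
      by (simp add: qpoch_inf_def)
    ultimately show ?thesis
      by (simp add: True qpoch_inf_list_def)
  next
    case False
    then have "t \<noteq> 0"
      by (simp add: t_def)
    have "2 * t * (P * F) = P * (E + t * F) - P * (E - t * F)"
      by (simp add: algebra_simps)
    then have "P * F = B"
      unfolding p m using \<open>t \<noteq> 0\<close> by simp
    then have "F = B / P"
      using P by (simp add: eq_divide_eq mult.commute)
    then show ?thesis
      using has_sum_infsum[OF D(4)[OF t(1)]] by (simp only: F_def B_def P_def)
  qed
qed

section \<open>From single sums to double sums\<close>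

text \<open>Group the pairs by \<open>n = j + k\<close>: the inner sum over \<open>j\<close> is
  \<open>q_Vandermonde_limit\<close>. The geometric bound on \<open>g\<close> gives absolute
  convergence, which justifies the regrouping.\<close>

lemma has_sum_q_Vandermonde:
  assumes p: "norm p < 1" and c: "norm c < 1"
    and g: "\<And>n. norm (g n) \<le> K * r ^ n" and r: "0 \<le> r" "r < 1"
    and S: "((\<lambda>n. g n / (fpoch c p n * fpoch p p n)) has_sum S) UNIV"
  shows "((\<lambda>(j, k). g (j + k) * (p ^ (j * (j - 1)) * c ^ j) / (fpoch c p j * fpoch p p j * fpoch p p k))
      has_sum S) UNIV"
proof -
  define F where "F = (\<lambda>(j, k). g (j + k) * (p ^ (j * (j - 1)) * c ^ j) / (fpoch c p j * fpoch p p j * fpoch p p k))"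
  obtain C where C: "C > 0" "\<And>n. norm (1 / fpoch p p n) \<le> C"
    using inverse_fpoch_bound[OF p p] by blast
  obtain D where D: "D > 0" "\<And>n. norm (1 / fpoch c p n) \<le> D"
    using inverse_fpoch_bound[OF c p] by blast
  have geom: "((^) r has_sum (1 / (1 - r))) UNIV"
    using r geometric_sums[of r] by (intro norm_summable_imp_has_sum) (auto simp: summable_geometric)
  have "(\<lambda>x. case x of (j, k) \<Rightarrow> r ^ j * r ^ k) summable_on Sigma UNIV (\<lambda>_. UNIV)"
  proof (rule summable_on_SigmaI)
    show "((\<lambda>k. case (j, k) of (j, k) \<Rightarrow> r ^ j * r ^ k) has_sum r ^ j * (1 / (1 - r))) UNIV" for j :: nat
      using has_sum_cmult_right[OF geom] by simp
    show "(\<lambda>j. r ^ j * (1 / (1 - r))) summable_on (UNIV :: nat set)"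
      by (rule has_sum_imp_summable[OF has_sum_cmult_left[OF geom]])
  qed (use r in auto)
  then have "(\<lambda>x. K * D * C * C * (case x of (j, k) \<Rightarrow> r ^ j * r ^ k)) summable_on (UNIV :: (nat \<times> nat) set)"
    by (intro summable_on_cmult_right) simp
  then have "(\<lambda>x. norm (F x)) summable_on UNIV"
  proof (rule Infinite_Sum.abs_summable_on_comparison_test')
    fix x :: "nat \<times> nat"
    obtain j k where x: "x = (j, k)" by fastforce
    have "norm (F x) = norm (g (j + k)) * (norm p ^ (j * (j - 1)) * norm c ^ j)
        * norm (1 / fpoch c p j) * norm (1 / fpoch p p j) * norm (1 / fpoch p p k)"
      by (simp add: F_def x norm_mult norm_divide norm_power)
    \<comment> \<open>The powers of \<open>p\<close> and \<open>c\<close> are bounded by 1; the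
      decay comes from \<open>g\<close> alone.\<close>
    also have "\<dots> \<le> K * r ^ (j + k) * (1 * 1) * D * C * C"
      using p c g[of "j + k"] C D order_trans[OF norm_ge_zero g[of "j + k"]]
      by (intro mult_mono power_le_one) (auto intro!: mult_nonneg_nonneg less_imp_le)
    finally show "norm (F x) \<le> K * D * C * C * (case x of (j, k) \<Rightarrow> r ^ j * r ^ k)"
      by (simp add: x power_add mult_ac)
  qed
  then have FU: "F summable_on UNIV"
    by (rule abs_summable_summable)
  \<comment> \<open>Enumerates the pairs by antidiagonals.\<close>
  have bij: "bij_betw (\<lambda>(n, j). (j, n - j)) (SIGMA n:UNIV. {..n}) (UNIV :: (nat \<times> nat) set)"
    by (rule bij_betw_byWitness[of _ "\<lambda>(j, k). (j + k, j)"]) auto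
  have "((\<lambda>x. F (case x of (n, j) \<Rightarrow> (j, n - j))) has_sum S) (SIGMA n:UNIV. {..n})"
  proof (rule has_sum_SigmaI[OF _ S])
    show "(\<lambda>x. F (case x of (n, j) \<Rightarrow> (j, n - j))) summable_on (SIGMA n:UNIV. {..n})"
      using FU summable_on_reindex_bij_betw[OF bij, of F] by simp
    fix n
    have nz: "fpoch p p n \<noteq> 0"
      using fpoch_nonzero[OF p p] .
    have "(\<Sum>j\<le>n. F (j, n - j))
        = (\<Sum>j\<le>n. g n / fpoch p p n * (qbinom p n j * (p ^ (j * (j - 1)) * c ^ j / fpoch c p j)))"
      using nz by (intro sum.cong) (auto simp: F_def qbinom_def)
    also have "\<dots> = g n / fpoch p p n * (1 / fpoch c p n)"
      by (simp only: sum_distrib_left[symmetric] q_Vandermonde_limit[OF p c])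
    finally have "(\<Sum>j\<le>n. F (j, n - j)) = g n / (fpoch c p n * fpoch p p n)"
      by simp
    then show "((\<lambda>j. F (case (n, j) of (n, j) \<Rightarrow> (j, n - j))) has_sum g n / (fpoch c p n * fpoch p p n)) {..n}"
      using has_sum_finite[of "{..n}" "\<lambda>j. F (j, n - j)"] by simp
  qed
  then have "(F has_sum S) UNIV"
    using has_sum_reindex_bij_betw[OF bij, of F S] by simp
  then show ?thesis
    by (simp add: F_def)
qed

text \<open>The case \<open>p = q\<^sup>2\<close>, \<open>c = q\<close>,
  \<open>g n = q ^ (2 * n\<^sup>2)\<close> of the summation above, since
  \<open>fpoch q q (2 * n)\<close> splits by parity.\<close>

lemma double_sum_Slater_39:
  fixes q :: complex
  assumes "norm q < 1"
  shows "((\<lambda>(j::nat, k::nat).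
             q powi (4 * int j ^ 2 + 4 * int j * int k + 2 * int k ^ 2 - int j)
               / (qpoch q q (2 * j) * qpoch (q ^ 2) (q ^ 2) k))
           has_sum (qpoch_inf_list [q ^ 8, - (q ^ 3), - (q ^ 5)] (q ^ 8) / qpoch_inf (q ^ 2) (q ^ 2)))
           UNIV"
proof -
  have q2: "norm (q\<^sup>2) < 1"
    using assms by (auto intro: norm_power_less_1)
  have qp: "qpoch q q n = fpoch q q n" "qpoch (q\<^sup>2) (q\<^sup>2) n = fpoch (q\<^sup>2) (q\<^sup>2) n" for n
    using assms q2 by (simp_all add: qpoch_eq_fpoch)
  have ev: "fpoch q q (2 * n) = fpoch q (q\<^sup>2) n * fpoch (q\<^sup>2) (q\<^sup>2) n" for n
    using fpoch_even[of q q n] by (simp add: power2_eq_square)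
  have jj: "2 * (j * (j - 1)) + 2 * j = 2 * j\<^sup>2" for j :: nat
    by (cases j) (simp_all add: power2_eq_square)

  have "norm (q ^ (2 * n\<^sup>2)) \<le> 1 * norm q ^ n" for n
    using assms by (simp add: norm_power power_decreasing power2_eq_square)
  moreover have "((\<lambda>n. q ^ (2 * n\<^sup>2) / (fpoch q (q\<^sup>2) n * fpoch (q\<^sup>2) (q\<^sup>2) n)) has_sum
      (qpoch_inf_list [q ^ 8, - (q ^ 3), - (q ^ 5)] (q ^ 8) / qpoch_inf (q\<^sup>2) (q\<^sup>2))) UNIV"
    using Slater_39[OF assms] by (simp add: ev)
  ultimately have "((\<lambda>(j, k). q ^ (2 * (j + k)\<^sup>2) * ((q\<^sup>2) ^ (j * (j - 1)) * q ^ j)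
        / (fpoch q (q\<^sup>2) j * fpoch (q\<^sup>2) (q\<^sup>2) j * fpoch (q\<^sup>2) (q\<^sup>2) k))
      has_sum (qpoch_inf_list [q ^ 8, - (q ^ 3), - (q ^ 5)] (q ^ 8) / qpoch_inf (q\<^sup>2) (q\<^sup>2))) UNIV"
    using assms by (intro has_sum_q_Vandermonde[where r = "norm q" and K = 1] q2) auto
  \<comment> \<open>The integer exponent equals \<open>2(j + k)^2 + 2j(j - 1) + j\<close>, so it is
    a natural number and \<open>powi\<close> is an ordinary power, also at
    \<open>q = 0\<close>.\<close>
  moreover have "q powi (4 * int j ^ 2 + 4 * int j * int k + 2 * int k ^ 2 - int j)
      = q ^ (2 * (j + k)\<^sup>2) * ((q\<^sup>2) ^ (j * (j - 1)) * q ^ j)" for j k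
  proof -
    define d where "d = j * (j - 1)"
    have "2 * int d + 2 * int j = 2 * int j ^ 2"
      using arg_cong[OF jj[of j], of int] by (simp add: d_def)
    moreover have "int (2 * (j + k)\<^sup>2 + 2 * d + j)
        = 2 * int j ^ 2 + 2 * int k ^ 2 + 4 * int j * int k + 2 * int d + int j"
      by (simp add: power2_sum)
    ultimately have "4 * int j ^ 2 + 4 * int j * int k + 2 * int k ^ 2 - int j
        = int (2 * (j + k)\<^sup>2 + 2 * d + j)"
      by linarith
    then have "q powi (4 * int j ^ 2 + 4 * int j * int k + 2 * int k ^ 2 - int j)
        = q ^ (2 * (j + k)\<^sup>2 + 2 * d + j)"
      by (simp only: power_int_of_nat)
    then show ?thesis
      by (simp only: d_def power_add power_mult mult.assoc)
  qed
  ultimately show ?thesis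
    by (simp add: qp ev)
qed

text \<open>Here \<open>p = q\<^sup>2\<close> and \<open>c = q ^ 3\<close>. The first factor
  \<open>1 - q\<close> of the odd-length product is absorbed into \<open>g\<close>, and the
  remaining \<open>2n\<close> factors split by parity.\<close>

lemma double_sum_Slater_38:
  fixes q :: complex
  assumes "norm q < 1"
  shows "((\<lambda>(j::nat, k::nat).
             q ^ (4 * j ^ 2 + 4 * j * k + 2 * k ^ 2 + 3 * j + 2 * k)
               / (qpoch q q (1 + 2 * j) * qpoch (q ^ 2) (q ^ 2) k))
           has_sum (qpoch_inf_list [q ^ 8, - q, - (q ^ 7)] (q ^ 8) / qpoch_inf (q ^ 2) (q ^ 2)))
           UNIV"
proof -
  have q2: "norm (q\<^sup>2) < 1" and q3: "norm (q ^ 3) < 1"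
    using assms by (auto intro: norm_power_less_1)
  have qp: "qpoch q q n = fpoch q q n" "qpoch (q\<^sup>2) (q\<^sup>2) n = fpoch (q\<^sup>2) (q\<^sup>2) n" for n
    using assms q2 by (simp_all add: qpoch_eq_fpoch)
  have od: "fpoch q q (1 + 2 * n) = (1 - q) * (fpoch (q ^ 3) (q\<^sup>2) n * fpoch (q\<^sup>2) (q\<^sup>2) n)" for n
    using fpoch_Suc_shift[of q q "2 * n"] fpoch_even[of "q * q" q n]
    by (simp add: power2_eq_square power3_eq_cube mult_ac)
  have jj: "2 * (j * (j - 1)) + 2 * j = 2 * j\<^sup>2" for j :: nat
    by (cases j) (simp_all add: power2_eq_square)

  have "norm (q ^ (2 * n\<^sup>2 + 2 * n) / (1 - q)) \<le> norm (1 / (1 - q)) * norm q ^ n" for n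
    using assms by (simp add: norm_divide norm_power power_decreasing divide_right_mono)
  moreover have "((\<lambda>n. q ^ (2 * n\<^sup>2 + 2 * n) / (1 - q) / (fpoch (q ^ 3) (q\<^sup>2) n * fpoch (q\<^sup>2) (q\<^sup>2) n)) has_sum
      (qpoch_inf_list [q ^ 8, - q, - (q ^ 7)] (q ^ 8) / qpoch_inf (q\<^sup>2) (q\<^sup>2))) UNIV"
    using Slater_38[OF assms] by (simp only: od divide_divide_eq_left)
  ultimately have "((\<lambda>(j, k). q ^ (2 * (j + k)\<^sup>2 + 2 * (j + k)) / (1 - q) * ((q\<^sup>2) ^ (j * (j - 1)) * (q ^ 3) ^ j)
        / (fpoch (q ^ 3) (q\<^sup>2) j * fpoch (q\<^sup>2) (q\<^sup>2) j * fpoch (q\<^sup>2) (q\<^sup>2) k))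
      has_sum (qpoch_inf_list [q ^ 8, - q, - (q ^ 7)] (q ^ 8) / qpoch_inf (q\<^sup>2) (q\<^sup>2))) UNIV"
    using assms by (intro has_sum_q_Vandermonde[where r = "norm q" and K = "norm (1 / (1 - q))"] q2 q3) auto
  moreover have "q ^ (4 * j ^ 2 + 4 * j * k + 2 * k ^ 2 + 3 * j + 2 * k)
      = q ^ (2 * (j + k)\<^sup>2 + 2 * (j + k)) * ((q\<^sup>2) ^ (j * (j - 1)) * (q ^ 3) ^ j)" for j k
  proof -
    have "4 * j ^ 2 + 4 * j * k + 2 * k ^ 2 + 3 * j + 2 * k
        = 2 * (j + k)\<^sup>2 + 2 * (j + k) + (2 * (j * (j - 1)) + 3 * j)"
      using jj[of j] by (simp add: power2_eq_square algebra_simps)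
    then show ?thesis
      by (simp only: power_add power_mult mult.assoc)
  qed
  ultimately show ?thesis
    by (simp only: qp od times_divide_eq_left divide_divide_eq_left mult.assoc)
qed

theorem theorem4p1:
  fixes q :: complex
  assumes "norm q < 1"
  shows "((\<lambda>(j::nat, k::nat).
             q powi (4 * int j ^ 2 + 4 * int j * int k + 2 * int k ^ 2 - int j)
               / (qpoch q q (2 * j) * qpoch (q ^ 2) (q ^ 2) k))
           has_sum (qpoch_inf_list [q ^ 8, - (q ^ 3), - (q ^ 5)] (q ^ 8) / qpoch_inf (q ^ 2) (q ^ 2)))
           UNIV
       \<and> ((\<lambda>(j::nat, k::nat).
             q ^ (4 * j ^ 2 + 4 * j * k + 2 * k ^ 2 + 3 * j + 2 * k)
               / (qpoch q q (1 + 2 * j) * qpoch (q ^ 2) (q ^ 2) k))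
           has_sum (qpoch_inf_list [q ^ 8, - q, - (q ^ 7)] (q ^ 8) / qpoch_inf (q ^ 2) (q ^ 2)))
           UNIV"
  using double_sum_Slater_39[OF assms] double_sum_Slater_38[OF assms] by (rule conjI)

end
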